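(* Let $0\le\alpha<1$, let $s\ge 2$ and $n\ge s+1$ be integers. Among all $\widetilde{\infty}$-digraphs on $n$ vertices consisting of $s$ directed cycles, the digraph $\widetilde{\infty}(1,1,\ldots,1,n-s)$ (with $s-1$ parameters equal to $1$) is the unique digraph attaining the maximum $A_\alpha$ spectral radius, and the digraph $\widetilde{\infty}(a_1,a_2,\ldots,a_s)$ with $a_i=\lfloor \frac{n-1}{s}\rfloor$ for $i\in\{1,\ldots,s-(n-1-s\lfloor\frac{n-1}{s}\rfloor)\}$ and $a_j=\lceil\frac{n-1}{s}\rceil$ for $j\in\{s-(n-1-s\lfloor\frac{n-1}{s}\rfloor)+1,\ldots,s\}$ is the unique digraph attaining the minimum $A_\alpha$ spectral radius.
   Context: All digraphs are simple (no loops, no multiple arcs). For a digraph $G$ with vertices $v_1,\dots,v_n$, $A(G)$ is its adjacency matrix ($a_{ij}=1$ iff $(v_i,v_j)$ is an arc) and $D(G)$ is the diagonal matrix of outdegrees. For $\alpha\in[0,1)$, $A_\alpha(G)=\alpha D(G)+(1-\alpha)A(G)$, and the $A_\alpha$ spectral radius $\lambda_\alpha(G)$ is the largest modulus of an eigenvalue of $A_\alpha(G)$. For integers $k_1,\dots,k_s\ge 1$ ($s\ge2$), $\widetilde{\infty}(k_1,\ldots,k_s)$ denotes the digraph consisting of $s$ directed cycles of lengths $k_1+1,\ldots,k_s+1$ which pairwise share exactly one common vertex (the same vertex for all cycles); it has $n=\sum_{i=1}^s k_i+1$ vertices, and it depends (up to isomorphism) only on the multiset $\{k_1,\dots,k_s\}$.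 Such digraphs are called $\widetilde{\infty}$-digraphs. *)

theory Defs
  imports
    Complex_Main
    "Graph_Theory.Graph_Theory"
    "Jordan_Normal_Form.Spectral_Radius"
begin

section \<open>The matrix \<open>A\<^sub>\<alpha>\<close> of a digraph and its spectral radius\<close>

text \<open>
  Rows and columns are indexed by positions in a list \<open>vs\<close> that enumerates the vertices without
  repetition.
\<close>

definition adjacency_matrix :: "'a pair_pre_digraph \<Rightarrow> 'a list \<Rightarrow> real mat" where
  "adjacency_matrix G vs =
     mat (length vs) (length vs) (\<lambda>(i, j). if (vs ! i, vs ! j) \<in> parcs G then 1 else 0)"

definition outdegree_matrix :: "'a pair_pre_digraph \<Rightarrow> 'a list \<Rightarrow> real mat" where
  "outdegree_matrix G vs =
     mat (length vs) (length vs)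
       (\<lambda>(i, j). if i = j then real (out_degree (with_proj G) (vs ! i)) else 0)"

definition A_alpha :: "real \<Rightarrow> 'a pair_pre_digraph \<Rightarrow> 'a list \<Rightarrow> real mat" where
  "A_alpha \<alpha> G vs = \<alpha> \<cdot>\<^sub>m outdegree_matrix G vs + (1 - \<alpha>) \<cdot>\<^sub>m adjacency_matrix G vs"

text \<open>
  The choice of the enumeration is immaterial, see \<open>A_alpha_spectral_radius_eq\<close> below.
\<close>

definition A_alpha_spectral_radius :: "real \<Rightarrow> 'a pair_pre_digraph \<Rightarrow> real" where
  "A_alpha_spectral_radius \<alpha> G =
     spectral_radius (map_mat complex_of_real
       (A_alpha \<alpha> G (SOME vs. distinct vs \<and> set vs = pverts G)))"

lemma eigenvalue_mat_enum:
  fixes m :: "'a \<Rightarrow> 'a \<Rightarrow> 'b :: field"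
  assumes vs: "distinct vs"
  shows "eigenvalue (mat (length vs) (length vs) (\<lambda>(i, j). m (vs ! i) (vs ! j))) k \<longleftrightarrow>
    (\<exists>f. (\<exists>x\<in>set vs. f x \<noteq> 0) \<and> (\<forall>x\<in>set vs. (\<Sum>y\<in>set vs. m x y * f y) = k * f x))"
    (is "eigenvalue ?M k \<longleftrightarrow> ?R")
proof -
  let ?n = "length vs"
  have sum_nth: "(\<Sum>y\<in>set vs. g y) = (\<Sum>j = 0..<?n. g (vs ! j))" for g :: "'a \<Rightarrow> 'b"
    using sum_list_distinct_conv_sum_set[OF vs, of g]
    by (simp add: sum_list_sum_nth)
  have row: "(?M *\<^sub>v vec ?n (\<lambda>i. f (vs ! i))) $ i = (\<Sum>y\<in>set vs. m (vs ! i) y * f y)"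
    if "i < ?n" for f i
    using that by (simp add: sum_nth scalar_prod_def)
  show ?thesis
  proof
    assume "eigenvalue ?M k"
    then obtain v where v: "v \<in> carrier_vec ?n" "v \<noteq> 0\<^sub>v ?n" "?M *\<^sub>v v = k \<cdot>\<^sub>v v"
      by (auto simp: eigenvalue_def eigenvector_def)
    define f where "f x = v $ (THE i. i < ?n \<and> vs ! i = x)" for x
    have f: "f (vs ! i) = v $ i" if "i < ?n" for i
    proof -
      have "(THE j. j < ?n \<and> vs ! j = vs ! i) = i"
        using that vs by (intro the_equality) (auto simp: nth_eq_iff_index_eq)
      thus ?thesis by (simp add: f_def)
    qed
    have v_eq: "v = vec ?n (\<lambda>i. f (vs ! i))"
      using v(1) by (intro eq_vecI) (auto simp: f)
    have "\<exists>i<?n. v $ i \<noteq> 0"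
    proof (rule ccontr)
      assume "\<not> ?thesis"
      hence "v = 0\<^sub>v ?n" using v(1) by (intro eq_vecI) auto
      with v(2) show False by simp
    qed
    hence "\<exists>x\<in>set vs. f x \<noteq> 0" using f by (metis nth_mem)
    moreover have "(\<Sum>y\<in>set vs. m x y * f y) = k * f x" if x: "x \<in> set vs" for x
    proof -
      obtain i where i: "i < ?n" "x = vs ! i" using x by (auto simp: in_set_conv_nth)
      have "(\<Sum>y\<in>set vs. m x y * f y) = (?M *\<^sub>v v) $ i"
        unfolding i(2) row[OF i(1), of f, symmetric] v_eq[symmetric] ..
      also have "\<dots> = k * f x" using i v(1) by (simp add: v(3) f)
      finally show ?thesis .
    qed
    ultimately show ?R by blast
  next
    assume ?R
    then obtain f where f: "\<exists>x\<in>set vs. f x \<noteq> 0"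
      "\<And>x. x \<in> set vs \<Longrightarrow> (\<Sum>y\<in>set vs. m x y * f y) = k * f x" by blast
    let ?v = "vec ?n (\<lambda>i. f (vs ! i))"
    obtain i where i: "i < ?n" "f (vs ! i) \<noteq> 0" using f(1) by (auto simp: in_set_conv_nth)
    have "?v $ i \<noteq> 0\<^sub>v ?n $ i" using i by simp
    hence "?v \<noteq> 0\<^sub>v ?n" by metis
    moreover have "?M *\<^sub>v ?v = k \<cdot>\<^sub>v ?v"
    proof (rule eq_vecI)
      fix j assume "j < dim_vec (k \<cdot>\<^sub>v ?v)"
      hence j: "j < ?n" by simp
      show "(?M *\<^sub>v ?v) $ j = (k \<cdot>\<^sub>v ?v) $ j"
        unfolding row[OF j] using j f(2)[of "vs ! j"] by simp
    qed simp
    ultimately show "eigenvalue ?M k"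
      unfolding eigenvalue_def eigenvector_def by (intro exI[of _ ?v]) auto
  qed
qed

lemma A_alpha_spectral_radius_eq:
  assumes "distinct vs" "set vs = pverts G"
  shows "A_alpha_spectral_radius \<alpha> G = spectral_radius (map_mat complex_of_real (A_alpha \<alpha> G vs))"
proof -
  define ws where "ws = (SOME vs. distinct vs \<and> set vs = pverts G)"
  have ws: "distinct ws" "set ws = set vs"
    using someI[of "\<lambda>vs. distinct vs \<and> set vs = pverts G" vs] assms by (auto simp: ws_def)
  define m where "m x y = complex_of_real
    (\<alpha> * (if x = y then real (out_degree (with_proj G) x) else 0) +
     (1 - \<alpha>) * (if (x, y) \<in> parcs G then 1 else 0))" for x y
  have mat_eq: "map_mat complex_of_real (A_alpha \<alpha> G us) =
      mat (length us) (length us) (\<lambda>(i, j). m (us ! i) (us ! j))" if "distinct us" for us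
    using that
    by (intro eq_matI)
      (auto simp: A_alpha_def outdegree_matrix_def adjacency_matrix_def m_def nth_eq_iff_index_eq)
  have "eigenvalue (map_mat complex_of_real (A_alpha \<alpha> G ws)) k \<longleftrightarrow>
      eigenvalue (map_mat complex_of_real (A_alpha \<alpha> G vs)) k" for k
    unfolding mat_eq[OF ws(1)] mat_eq[OF assms(1)]
      eigenvalue_mat_enum[OF ws(1)] eigenvalue_mat_enum[OF assms(1)] ws(2) ..
  hence "spectrum (map_mat complex_of_real (A_alpha \<alpha> G ws)) =
      spectrum (map_mat complex_of_real (A_alpha \<alpha> G vs))"
    by (auto simp: spectrum_def)
  thus ?thesis
    by (simp add: A_alpha_spectral_radius_def spectral_radius_def flip: ws_def)
qed

section \<open>\<open>\<infinity>\<close>-digraphs\<close>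

text \<open>
  The cycles are arc lists \<open>p i\<close>; the vertex set of a cycle is the set of tails of its arcs.
  A single \<open>v\<close> serves all pairs of cycles.
\<close>

definition is_infty_digraph :: "nat list \<Rightarrow> 'a pair_pre_digraph \<Rightarrow> bool" where
  "is_infty_digraph ks G \<longleftrightarrow>
     pair_digraph G \<and> 2 \<le> length ks \<and> (\<forall>k\<in>set ks. 1 \<le> k) \<and>
     (\<exists>v p. (\<forall>i<length ks. pre_digraph.cycle (with_proj G) (p i) \<and> length (p i) = ks ! i + 1) \<and>
            (\<forall>i<length ks. \<forall>j<length ks. i \<noteq> j \<longrightarrow> fst ` set (p i) \<inter> fst ` set (p j) = {v}) \<and>
            pverts G = (\<Union>i<length ks. fst ` set (p i)) \<and>
            parcs G = (\<Union>i<length ks. set (p i)))"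

definition infty_digraphs :: "nat \<Rightarrow> nat \<Rightarrow> 'a pair_pre_digraph set" where
  "infty_digraphs n s = {G. card (pverts G) = n \<and> (\<exists>ks. length ks = s \<and> is_infty_digraph ks G)}"

text \<open>
  A concrete copy of the \<open>\<infinity>\<close>-digraph with parameters \<open>ks\<close>: the common vertex is \<open>(0, 0)\<close>, and
  cycle \<open>i\<close> is \<open>(0, 0) \<rightarrow> (i, 1) \<rightarrow> \<dots> \<rightarrow> (i, ks ! i) \<rightarrow> (0, 0)\<close>.
\<close>

definition infty_vertex :: "nat list \<Rightarrow> nat \<Rightarrow> nat \<Rightarrow> nat \<times> nat" where
  "infty_vertex ks i j = (if j = 0 \<or> j = ks ! i + 1 then (0, 0) else (i, j))"

definition infty_digraph :: "nat list \<Rightarrow> (nat \<times> nat) pair_pre_digraph" where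
  "infty_digraph ks =
     \<lparr>pverts = {infty_vertex ks i j | i j. i < length ks \<and> j \<le> ks ! i},
      parcs = {(infty_vertex ks i j, infty_vertex ks i (j + 1)) | i j. i < length ks \<and> j \<le> ks ! i}\<rparr>"

lemma cas_map_upt:
  "pre_digraph.cas (with_proj G) (f a) (map (\<lambda>j. (f j, f (Suc j))) [a..<a + n]) (f (a + n))"
proof (induction n arbitrary: a)
  case 0
  show ?case by (simp add: pre_digraph.cas.simps)
next
  case (Suc n)
  have "[a..<a + Suc n] = a # [Suc a..<Suc a + n]" by (simp add: upt_conv_Cons)
  with Suc[of "Suc a"] show ?case by (simp add: pre_digraph.cas.simps)
qed

lemma is_infty_digraph_infty_digraph:
  assumes len: "2 \<le> length ks" and pos: "\<forall>k\<in>set ks. 1 \<le> k"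
  shows "is_infty_digraph ks (infty_digraph ks)"
proof -
  let ?G = "infty_digraph ks"
  let ?f = "infty_vertex ks"
  define p where "p i = map (\<lambda>j. (?f i j, ?f i (Suc j))) [0..<ks ! i + 1]" for i
  have V: "pverts ?G = (\<Union>i<length ks. ?f i ` {0..<ks ! i + 1})"
    by (fastforce simp: infty_digraph_def)
  have set_p: "set (p i) = (\<lambda>j. (?f i j, ?f i (Suc j))) ` {0..<ks ! i + 1}" for i
    by (simp add: p_def del: upt_Suc)
  have E: "parcs ?G = (\<Union>i<length ks. set (p i))"
    unfolding set_p by (fastforce simp: infty_digraph_def)
  have tails: "fst ` set (p i) = ?f i ` {0..<ks ! i + 1}" for i
    unfolding set_p by (simp add: image_image)
  have pos': "1 \<le> ks ! i" if "i < length ks" for i using pos that by simp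
  have f0: "?f i 0 = (0, 0)" "?f i (Suc (ks ! i)) = (0, 0)" for i by (simp_all add: infty_vertex_def)
  have heads: "snd ` set (p i) \<subseteq> ?f i ` {0..<ks ! i + 1}" for i
  proof -
    have "?f i (Suc j) \<in> ?f i ` {0..<ks ! i + 1}" if "j < ks ! i + 1" for j
    proof (cases "j = ks ! i")
      case True
      thus ?thesis using f0[of i] by (intro image_eqI[of _ _ 0]) auto
    next
      case False
      thus ?thesis using that by (intro imageI) auto
    qed
    thus ?thesis unfolding set_p by (auto simp del: One_nat_def)
  qed
  have neq: "?f i j \<noteq> ?f i (Suc j)" if "i < length ks" "j < ks ! i + 1" for i j
    using pos'[OF that(1)] that(2) by (auto simp: infty_vertex_def)
  have "pair_digraph ?G"
  proof
    fix e assume e: "e \<in> parcs ?G"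
    then obtain i where i: "i < length ks" "e \<in> set (p i)" by (auto simp: E)
    show "fst e \<in> pverts ?G" using i tails[of i] unfolding V by blast
    show "snd e \<in> pverts ?G" using i heads[of i] unfolding V by blast
    show "fst e \<noteq> snd e" using i neq[OF i(1)] unfolding set_p by auto
  next
    show "finite (pverts ?G)" unfolding V by auto
    show "finite (parcs ?G)" unfolding E by auto
  qed
  moreover have "pre_digraph.cycle (with_proj ?G) (p i)" if i: "i < length ks" for i
  proof -
    have "pre_digraph.cas (with_proj ?G) (0, 0) (p i) (0, 0)"
      using cas_map_upt[of ?G "?f i" 0 "ks ! i + 1"] f0[of i]
      by (simp add: p_def del: upt_Suc)
    moreover have "(0, 0) \<in> pverts ?G"
      using i f0(1)[of i] unfolding V by (force intro: image_eqI[of _ _ 0])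
    moreover have "set (p i) \<subseteq> parcs ?G" using i by (auto simp: E)
    ultimately have aw: "pre_digraph.awalk (with_proj ?G) (0, 0) (p i) (0, 0)"
      by (simp add: pre_digraph.awalk_def)
    have ne: "p i \<noteq> []" by (simp add: p_def)
    have "tl (pre_digraph.awalk_verts (with_proj ?G) (0, 0) (p i)) = map snd (p i)"
      using pre_digraph.awalk_verts_conv'[of "with_proj ?G" "(0, 0)" "p i" "(0, 0)"] aw ne
      by (simp add: pre_digraph.awalk_def)
    moreover have "distinct (map snd (p i))"
      using pos'[OF i]
      by (auto simp: p_def distinct_map inj_on_def infty_vertex_def comp_def
               simp del: upt_Suc split: if_splits)
    ultimately show ?thesis
      using aw ne unfolding pre_digraph.cycle_def by (intro exI[of _ "(0, 0)"]) simp
  qed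
  moreover have "length (p i) = ks ! i + 1" for i by (simp add: p_def)
  moreover have "fst ` set (p i) \<inter> fst ` set (p j) = {(0, 0)}"
    if "i < length ks" "j < length ks" "i \<noteq> j" for i j
  proof -
    have "(0, 0) \<in> ?f l ` {0..<ks ! l + 1}" for l
      using f0(1)[of l] by (intro image_eqI[of _ _ 0]) auto
    thus ?thesis using that(3) unfolding tails
      by (auto simp: infty_vertex_def simp del: One_nat_def split: if_splits)
  qed
  moreover have "pverts ?G = (\<Union>i<length ks. fst ` set (p i))" unfolding V tails ..
  ultimately show ?thesis
    using len pos E unfolding is_infty_digraph_def by blast
qed

text \<open>Here \<open>q = \<lfloor>(n - 1) / s\<rfloor>\<close>; the list is indexed from \<open>1\<close>.\<close>

definition balanced_params :: "nat \<Rightarrow> nat \<Rightarrow> nat list" where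
  "balanced_params n s =
     (let q = nat \<lfloor>(real n - 1) / real s\<rfloor>
      in map (\<lambda>i. if i \<le> s - (n - 1 - s * q) then q else nat \<lceil>(real n - 1) / real s\<rceil>) [1..<s + 1])"

end

theory Submission
  imports Defs
begin

text \<open>
  Write an eigenvalue other than \<open>\<alpha>\<close> as \<open>\<lambda> = \<alpha> + (1 - \<alpha>) \<mu>\<close>. Along a cycle each entry of an eigenvector
  is \<open>1 / \<mu>\<close> times the next one, so the equation at the common vertex becomes
  \<open>\<mu> = c + (\<Sum>i. (1 / \<mu>) ^ k\<^sub>i)\<close> with \<open>c = \<alpha> (s - 1) / (1 - \<alpha>)\<close>. As the right-hand side
  decreases for \<open>\<mu> > 0\<close>, there is exactly one positive root; it exceeds \<open>1\<close>, and by the triangle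
  inequality it bounds the modulus of every complex root. Hence comparing spectral radii amounts to
  comparing the power sums \<open>\<Sum>i. x ^ k\<^sub>i\<close> for \<open>0 < x < 1\<close> under the constraint
  \<open>(\<Sum>i. k\<^sub>i) = n - 1\<close>. The maximum follows from
  \<open>x + x ^ (a + b + 1) - x ^ (a + 1) - x ^ (b + 1) = x (1 - x ^ a) (1 - x ^ b)\<close>, and the minimum
  from the secant of the convex function \<open>k \<mapsto> x ^ k\<close> through \<open>q\<close> and \<open>q + 1\<close>, which lies strictly
  below the function at all other integers.
\<close>

section \<open>Power sums with a given exponent sum\<close>

text \<open>Induction along the list: the tail is first replaced by its own extreme list, then its
  large entry \<open>b + 1\<close> and the head \<open>a + 1\<close> are traded for
  \<open>a + b + 1\<close> and 1. The gain factors as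
  \<open>x * ((1 - x ^ a) * (1 - x ^ b))\<close>, which vanishes only if the trade changes nothing
  but the order.\<close>

lemma sum_powers_le_extreme:
  fixes x :: real
  assumes x: "0 < x" "x < 1" and "ks \<noteq> []" "\<forall>k\<in>set ks. 1 \<le> k"
  defines "ls \<equiv> replicate (length ks - 1) 1 @ [sum_list ks + 1 - length ks]"
  shows "(\<Sum>k\<leftarrow>ks. x ^ k) \<le> (\<Sum>k\<leftarrow>ls. x ^ k) \<and>
    ((\<Sum>k\<leftarrow>ks. x ^ k) = (\<Sum>k\<leftarrow>ls. x ^ k) \<longrightarrow> mset ks = mset ls)"
  using assms(3,4) unfolding ls_def
proof (induction ks rule: list_nonempty_induct)
  case (single k)
  thus ?case by simp
next
  case (cons k ks)
  \<comment> \<open>The extreme list of the tail has \<open>r\<close> ones and the entry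
    \<open>b + 1\<close>. Shifting by one makes \<open>a\<close> and \<open>b\<close> arbitrary
    naturals; as all entries are positive, no subtraction here is truncated.\<close>
  define r where "r = length ks - 1"
  define b where "b = sum_list ks - length ks"
  define a where "a = k - 1"
  have k: "k = a + 1" using cons.prems by (simp add: a_def)
  have "length ks \<le> sum_list ks"
    using cons.prems by (induction ks) auto
  hence b: "sum_list ks + 1 - length ks = b + 1"
      "sum_list (k # ks) + 1 - length (k # ks) = a + b + 1"
    by (simp_all add: b_def k)
  have r: "length ks = r + 1" using cons.hyps by (cases ks) (simp_all add: r_def)
  have IH: "(\<Sum>k\<leftarrow>ks. x ^ k) \<le> r * x + x ^ (b + 1)"
      "(\<Sum>k\<leftarrow>ks. x ^ k) = r * x + x ^ (b + 1) \<Longrightarrow> mset ks = mset (replicate r 1 @ [b + 1])"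
    using cons.IH cons.prems unfolding b(1) by (simp_all add: r sum_list_replicate)
  have id: "x + x ^ (a + b + 1) - x ^ (a + 1) - x ^ (b + 1) = x * ((1 - x ^ a) * (1 - x ^ b))"
    by (simp add: algebra_simps power_add)
  have ge: "0 \<le> 1 - x ^ m" for m using x by (simp add: power_le_one)
  have eq: "1 - x ^ m = 0 \<longleftrightarrow> m = 0" for m
    using x power_Suc_less_one[of x "m - 1"] by (cases m) auto
  have "0 \<le> x * ((1 - x ^ a) * (1 - x ^ b))" using x ge by simp
  hence le: "x ^ (a + 1) + x ^ (b + 1) \<le> x + x ^ (a + b + 1)" using id by linarith
  have rhs: "(\<Sum>k\<leftarrow>replicate (length (k # ks) - 1) 1 @ [a + b + 1]. x ^ k) =
      r * x + x + x ^ (a + b + 1)"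
    by (simp add: r sum_list_replicate algebra_simps)
  have lhs: "(\<Sum>k\<leftarrow>k # ks. x ^ k) = x ^ (a + 1) + (\<Sum>k\<leftarrow>ks. x ^ k)" by (simp add: k)
  have "mset (k # ks) = mset (replicate (length (k # ks) - 1) 1 @ [a + b + 1])"
    if "(\<Sum>k\<leftarrow>k # ks. x ^ k) = r * x + x + x ^ (a + b + 1)"
  proof -
    have 1: "(\<Sum>k\<leftarrow>ks. x ^ k) = r * x + x ^ (b + 1)"
        "x + x ^ (a + b + 1) - x ^ (a + 1) - x ^ (b + 1) = 0"
      using that le IH(1) unfolding lhs by linarith+
    \<comment> \<open>If \<open>a = 0\<close>, the head is one more 1; if \<open>b = 0\<close>, the
      tail consists of ones and the head is the large entry.\<close>
    hence "a = 0 \<or> b = 0" using x eq unfolding id by auto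
    thus ?thesis using IH(2)[OF 1(1)] by (auto simp: k r)
  qed
  thus ?case unfolding b(2) rhs using le IH(1) lhs by linarith
qed

text \<open>Factoring out the smaller of the powers, \<open>x ^ q\<close> for q \<le> k and
  \<open>x ^ k\<close> for k < q, leaves an inequality of Bernoulli type in the distance between
  \<open>k\<close> and \<open>q\<close>.\<close>

lemma power_ge_secant:
  fixes x :: real and k q :: nat
  assumes x: "0 < x" "x < 1"
  shows "x ^ q + (real k - real q) * (x ^ (q + 1) - x ^ q) \<le> x ^ k \<and>
    (x ^ q + (real k - real q) * (x ^ (q + 1) - x ^ q) = x ^ k \<longrightarrow> k = q \<or> k = q + 1)"
proof (cases "q \<le> k")
  case True
  then obtain d where d: "k = q + d" using le_Suc_ex by blast
  have B: "1 - real m * (1 - x) \<le> x ^ m" for m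
    using Bernoulli_inequality[of "x - 1" m] x by (simp add: algebra_simps)
  \<comment> \<open>Bernoulli becomes strict from exponent 2 on: multiplying the bound for exponent
    \<open>m + 1\<close> by \<open>x\<close> leaves the surplus \<open>(m + 1) (1 - x)^2\<close>. So
    equality forces \<open>d \<le> 1\<close>.\<close>
  have S: "1 - real (m + 2) * (1 - x) < x ^ (m + 2)" for m
  proof -
    have "x * (1 - real (m + 1) * (1 - x)) \<le> x * x ^ (m + 1)"
      using B[of "m + 1"] x by (intro mult_left_mono) auto
    moreover have "x * (1 - real (m + 1) * (1 - x)) =
        1 - real (m + 2) * (1 - x) + real (m + 1) * (1 - x)\<^sup>2"
      by (simp add: algebra_simps power2_eq_square)
    moreover have "0 < real (m + 1) * (1 - x)\<^sup>2" using x by simp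
    ultimately show ?thesis by simp
  qed
  have id: "x ^ k - (x ^ q + (real k - real q) * (x ^ (q + 1) - x ^ q)) =
      x ^ q * (x ^ d - (1 - real d * (1 - x)))"
    by (simp add: d algebra_simps power_add)
  have pq: "0 < x ^ q" using x by simp
  have "0 \<le> x ^ q * (x ^ d - (1 - real d * (1 - x)))" using B[of d] pq by simp
  moreover have "d \<le> 1" if "x ^ q * (x ^ d - (1 - real d * (1 - x))) = 0"
  proof (rule ccontr)
    assume "\<not> d \<le> 1"
    then obtain m where "d = m + 2" using le_Suc_ex[of 2 d] by auto
    thus False using that S[of m] pq by (metis less_irrefl mult_pos_pos diff_gt_0_iff_gt)
  qed
  ultimately show ?thesis unfolding id[symmetric] by (auto simp: d)
next
  case False
  then obtain d where d: "q = k + (d + 1)" using less_imp_Suc_add[of k q] by auto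
  \<comment> \<open>To the left of \<open>q\<close> there is no equality case: the distance is
    \<open>d + 1\<close>, at least 1, which excludes the exponent 0 where both sides would
    agree.\<close>
  have S: "x ^ (m + 1) * (1 + real (m + 1) * (1 - x)) < 1" for m
  proof (induction m)
    case 0
    have "0 < (1 - x)\<^sup>2" using x by simp
    thus ?case by (simp add: algebra_simps power2_eq_square)
  next
    case (Suc m)
    have "x * (1 + real (m + 2) * (1 - x)) = 1 + real (m + 1) * (1 - x) - real (m + 2) * (1 - x)\<^sup>2"
      by (simp add: algebra_simps power2_eq_square)
    also have "\<dots> \<le> 1 + real (m + 1) * (1 - x)" by simp
    finally have "x ^ (m + 1) * (x * (1 + real (m + 2) * (1 - x))) \<le>
        x ^ (m + 1) * (1 + real (m + 1) * (1 - x))"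
      using x by (intro mult_left_mono) auto
    with Suc show ?case by (simp add: algebra_simps)
  qed
  have id: "x ^ k - (x ^ q + (real k - real q) * (x ^ (q + 1) - x ^ q)) =
      x ^ k * (1 - x ^ (d + 1) * (1 + real (d + 1) * (1 - x)))"
    by (simp add: d algebra_simps power_add)
  have "0 < x ^ k * (1 - x ^ (d + 1) * (1 + real (d + 1) * (1 - x)))"
    using S[of d] x by (intro mult_pos_pos) auto
  thus ?thesis unfolding id[symmetric] by simp
qed

text \<open>The sum of an affine function over a list depends only on length and total. Hence the
  secant \<open>g\<close>, which agrees with the power at \<open>q\<close> and \<open>q + 1\<close>,
  has over \<open>ks\<close> the sum that the powers have over \<open>ls\<close>, and the comparison
  is termwise.\<close>

lemma sum_powers_ge_balanced:
  fixes x :: real and q r :: nat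
  assumes x: "0 < x" "x < 1" and sum: "sum_list ks = length ks * q + r" and r: "r \<le> length ks"
  defines "ls \<equiv> replicate (length ks - r) q @ replicate r (q + 1)"
  shows "(\<Sum>k\<leftarrow>ls. x ^ k) \<le> (\<Sum>k\<leftarrow>ks. x ^ k)"
    and "(\<Sum>k\<leftarrow>ks. x ^ k) = (\<Sum>k\<leftarrow>ls. x ^ k) \<Longrightarrow> mset ks = mset ls"
proof -
  define g where "g k = x ^ q + (real k - real q) * (x ^ (q + 1) - x ^ q)" for k :: nat
  have sum_g: "(\<Sum>k\<leftarrow>ks. g k) = length ks * x ^ q +
      (real (sum_list ks) - length ks * real q) * (x ^ (q + 1) - x ^ q)" for ks
    by (induction ks) (simp_all add: g_def algebra_simps)
  have eq: "(\<Sum>k\<leftarrow>ls. x ^ k) = (\<Sum>k\<leftarrow>ks. g k)"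
    unfolding sum_g sum ls_def using r
    by (simp add: sum_list_replicate of_nat_diff algebra_simps)
  have g: "g k \<le> x ^ k" "g k = x ^ k \<Longrightarrow> k = q \<or> k = q + 1" for k
    using power_ge_secant[OF x, of q k] by (simp_all add: g_def)
  show "(\<Sum>k\<leftarrow>ls. x ^ k) \<le> (\<Sum>k\<leftarrow>ks. x ^ k)"
    unfolding eq by (intro sum_list_mono g)
  assume "(\<Sum>k\<leftarrow>ks. x ^ k) = (\<Sum>k\<leftarrow>ls. x ^ k)"
  hence "(\<Sum>k\<leftarrow>ks. x ^ k) = (\<Sum>k\<leftarrow>ks. g k)" using eq by simp
  hence "\<forall>k\<in>set ks. g k = x ^ k"
  proof (induction ks)
    case (Cons k ks)
    have "(\<Sum>k\<leftarrow>ks. g k) \<le> (\<Sum>k\<leftarrow>ks. x ^ k)" by (intro sum_list_mono g)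
    with Cons.prems g(1)[of k] have "g k = x ^ k" "(\<Sum>k\<leftarrow>ks. x ^ k) = (\<Sum>k\<leftarrow>ks. g k)"
      by simp_all
    with Cons.IH show ?case by simp
  qed simp
  hence "set ks \<subseteq> {q, q + 1}" using g(2) by blast
  \<comment> \<open>Here \<open>r'\<close> counts the entries \<open>q + 1\<close>; the prescribed
    total then forces \<open>r' = r\<close>.\<close>
  hence "\<exists>r'\<le>length ks. sum_list ks = length ks * q + r' \<and>
      mset ks = mset (replicate (length ks - r') q @ replicate r' (q + 1))"
  proof (induction ks)
    case (Cons k ks)
    then obtain r' where r': "r' \<le> length ks" "sum_list ks = length ks * q + r'"
        "mset ks = mset (replicate (length ks - r') q @ replicate r' (q + 1))" by auto
    from Cons.prems consider "k = q" | "k = q + 1" by auto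
    thus ?case
    proof cases
      case 1
      thus ?thesis using r' by (intro exI[of _ r']) (simp add: Suc_diff_le)
    next
      case 2
      thus ?thesis using r' by (intro exI[of _ "r' + 1"]) simp
    qed
  qed simp
  thus "mset ks = mset ls" using sum by (auto simp: ls_def)
qed

section \<open>Roots of the equation at the common vertex\<close>

lemma exists_root_gt_one:
  fixes c :: real
  assumes c: "0 \<le> c" and len: "2 \<le> length ks"
  shows "\<exists>\<mu>>1. \<mu> = c + (\<Sum>k\<leftarrow>ks. (1 / \<mu>) ^ k)"
proof -
  define h where "h \<mu> = \<mu> - c - (\<Sum>k\<leftarrow>ks. (1 / \<mu>) ^ k)" for \<mu> :: real
  \<comment> \<open>At \<open>M\<close> every power is at most 1, so the right-hand side is below
    \<open>M\<close>; at 1 it equals \<open>c + length ks\<close>, which exceeds 1. The intermediate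
    value theorem gives a root in between.\<close>
  define M where "M = c + length ks + 1"
  have sum_le: "(\<Sum>k\<leftarrow>ks. (1 / M) ^ k) \<le> length ks"
  proof -
    have "(1 / M) ^ k \<le> 1" for k using c by (intro power_le_one) (simp_all add: M_def)
    hence "(\<Sum>k\<leftarrow>ks. (1 / M) ^ k) \<le> (\<Sum>k\<leftarrow>ks. 1)" by (intro sum_list_mono)
    thus ?thesis by (simp add: sum_list_triv)
  qed
  have h1: "h 1 < 0" using c len by (simp add: h_def sum_list_triv)
  have "continuous_on {1..M} (\<lambda>\<mu>. \<Sum>k\<leftarrow>ks. (1 / \<mu>) ^ k)"
    by (induction ks) (auto intro!: continuous_intros)
  hence "continuous_on {1..M} h"
    unfolding h_def by (intro continuous_intros)
  moreover have "h M \<ge> 0" using sum_le by (simp add: h_def M_def)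
  ultimately obtain \<mu> where \<mu>: "1 \<le> \<mu>" "h \<mu> = 0"
    using IVT'[of h 1 0 M] h1 c by (auto simp: M_def)
  hence "\<mu> \<noteq> 1" using h1 by auto
  thus ?thesis using \<mu> by (intro exI[of _ \<mu>]) (auto simp: h_def)
qed

lemma sum_powers_inverse_antimono:
  fixes \<mu> \<nu> :: real
  assumes "0 < \<mu>" "\<mu> \<le> \<nu>"
  shows "(\<Sum>k\<leftarrow>ks. (1 / \<nu>) ^ k) \<le> (\<Sum>k\<leftarrow>ks. (1 / \<mu>) ^ k)"
  using assms by (intro sum_list_mono power_mono) (simp_all add: frac_le)

section \<open>Isomorphic digraphs\<close>

text \<open>An arc is the pair of its ends, so the vertex map alone determines the map on arcs; no
  separate arc map as in \<open>digraph_isomorphism\<close> has to be carried along.\<close>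

definition pair_iso ::
    "('a \<Rightarrow> 'b) \<Rightarrow> 'a pair_pre_digraph \<Rightarrow> 'b pair_pre_digraph \<Rightarrow> bool" where
  "pair_iso F G H \<longleftrightarrow>
     inj_on F (pverts G) \<and> pverts H = F ` pverts G \<and> parcs H = map_prod F F ` parcs G"

lemma digraph_iso_if_pair_iso:
  assumes "pair_digraph G" "pair_iso F G H"
  shows "digraph_iso (with_proj G) (with_proj H)"
proof -
  interpret pair_digraph G by fact
  have wf: "wf_digraph (with_proj G)" by unfold_locales
  have arcs: "x \<in> pverts G" "y \<in> pverts G" if "(x, y) \<in> parcs G" for x y
    using that by (auto dest: arc_fst_in_verts arc_snd_in_verts)
  have inj: "inj_on F (pverts G)" using assms(2) by (simp add: pair_iso_def)
  have inj2: "inj_on (map_prod F F) (parcs G)"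
    using arcs by (intro inj_on_subset[OF map_prod_inj_on[OF inj inj]]) auto
  let ?f = "\<lparr>iso_verts = F, iso_arcs = map_prod F F, iso_head = snd, iso_tail = fst\<rparr>"
  have "pre_digraph.digraph_isomorphism (with_proj G) ?f"
    using wf inj inj2 by (auto simp: pre_digraph.digraph_isomorphism_def with_proj_def)
  moreover have "with_proj H = app_iso ?f (with_proj G)"
    using assms(2) by (simp add: pair_iso_def app_iso_def with_proj_def)
  ultimately show ?thesis unfolding digraph_iso_def by blast
qed

text \<open>Head and tail of \<open>with_proj H\<close> are the projections, so compatibility forces
  the arc map to be \<open>map_prod\<close> of the vertex map with itself.\<close>

lemma pair_iso_if_digraph_iso:
  assumes "digraph_iso (with_proj G) (with_proj H)"
  obtains F where "pair_iso F G H"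
proof -
  obtain f where f: "pre_digraph.digraph_isomorphism (with_proj G) f"
      "with_proj H = app_iso f (with_proj G)"
    using assms unfolding digraph_iso_def by blast
  have H: "pverts H = iso_verts f ` pverts G" "parcs H = iso_arcs f ` parcs G"
      "iso_tail f = fst" "iso_head f = snd"
    using f(2) by (simp_all add: app_iso_def with_proj_def)
  have "iso_arcs f e = map_prod (iso_verts f) (iso_verts f) e" if "e \<in> parcs G" for e
    using f(1) that H(3,4)
    by (auto simp: pre_digraph.digraph_isomorphism_def with_proj_def prod_eq_iff)
  hence "pair_iso (iso_verts f) G H"
    using f(1) H(1,2)
    by (auto simp: pair_iso_def pre_digraph.digraph_isomorphism_def with_proj_def
        intro!: image_cong)
  thus ?thesis by (rule that)
qed

lemma digraph_iso_pair_sym: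
  assumes "pair_digraph G" "digraph_iso (with_proj G) (with_proj H)"
  shows "digraph_iso (with_proj H) (with_proj G)"
proof -
  obtain f where f: "pre_digraph.digraph_isomorphism (with_proj G) f"
      "with_proj H = app_iso f (with_proj G)"
    using assms unfolding digraph_iso_def by blast
  interpret pair_digraph G by fact
  have wf: "wf_digraph (with_proj G)" by unfold_locales
  show ?thesis
    using wf_digraph.digraph_isomorphism_invI[OF wf f(1)] pre_digraph.app_iso_inv[OF f(1)] f(2)
    unfolding digraph_iso_def by metis
qed

lemma out_degree_with_proj:
  "out_degree (with_proj G) x = card {y. (x, y) \<in> parcs G}"
proof -
  have "out_arcs (with_proj G) x = Pair x ` {y. (x, y) \<in> parcs G}"
    by (auto simp: out_arcs_def with_proj_def)
  thus ?thesis by (simp add: out_degree_def card_image inj_on_def)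
qed

text \<open>Enumerating \<open>H\<close> by the images of an enumeration of \<open>G\<close> yields
  the very same matrix, and the spectral radius does not depend on the enumeration.\<close>

lemma A_alpha_spectral_radius_pair_iso:
  assumes G: "pair_digraph G" and iso: "pair_iso F G H"
  shows "A_alpha_spectral_radius \<alpha> H = A_alpha_spectral_radius \<alpha> G"
proof -
  interpret pair_digraph G by fact
  have arcs: "x \<in> pverts G" "y \<in> pverts G" if "(x, y) \<in> parcs G" for x y
    using that by (auto dest: arc_fst_in_verts arc_snd_in_verts)
  have inj: "inj_on F (pverts G)" and pv: "pverts H = F ` pverts G"
    and pa: "parcs H = map_prod F F ` parcs G" using iso by (simp_all add: pair_iso_def)
  obtain vs where vs: "distinct vs" "set vs = pverts G"
    using finite_distinct_list[of "pverts G"] pair_finite_verts by blast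
  have arc_iff: "(F x, F y) \<in> parcs H \<longleftrightarrow> (x, y) \<in> parcs G"
    if "x \<in> pverts G" "y \<in> pverts G" for x y
  proof
    assume "(F x, F y) \<in> parcs H"
    then obtain x' y' where e: "(x', y') \<in> parcs G" "F x = F x'" "F y = F y'"
      unfolding pa by auto
    have "x = x'" "y = y'" using inj_onD[OF inj] e arcs[OF e(1)] that by auto
    thus "(x, y) \<in> parcs G" using e(1) by simp
  qed (force simp: pa)
  have deg: "out_degree (with_proj H) (F x) = out_degree (with_proj G) x"
    if x: "x \<in> pverts G" for x
  proof -
    have "{y. (F x, y) \<in> parcs H} = F ` {y. (x, y) \<in> parcs G}"
    proof (intro equalityI subsetI)
      fix y assume y: "y \<in> {y. (F x, y) \<in> parcs H}"
      then obtain y' where y': "y = F y'" "y' \<in> pverts G" unfolding pa using arcs by auto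
      thus "y \<in> F ` {y. (x, y) \<in> parcs G}" using y arc_iff[OF x y'(2)] by auto
    next
      fix y assume "y \<in> F ` {y. (x, y) \<in> parcs G}"
      thus "y \<in> {y. (F x, y) \<in> parcs H}" using arc_iff[OF x] arcs by auto
    qed
    moreover have "inj_on F {y. (x, y) \<in> parcs G}"
      using arcs by (intro inj_on_subset[OF inj]) auto
    ultimately show ?thesis by (simp add: out_degree_with_proj card_image)
  qed
  have mem: "vs ! i \<in> pverts G" if "i < length vs" for i
    using nth_mem[OF that] vs(2) by simp
  have "A_alpha \<alpha> H (map F vs) = A_alpha \<alpha> G vs"
  proof (rule eq_matI)
    fix i j assume "i < dim_row (A_alpha \<alpha> G vs)" "j < dim_col (A_alpha \<alpha> G vs)"
    hence ij: "i < length vs" "j < length vs"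
      by (simp_all add: A_alpha_def outdegree_matrix_def adjacency_matrix_def)
    show "A_alpha \<alpha> H (map F vs) $$ (i, j) = A_alpha \<alpha> G vs $$ (i, j)"
      using ij arc_iff[OF mem mem, OF ij] deg[OF mem, OF ij(2)]
      by (simp add: A_alpha_def outdegree_matrix_def adjacency_matrix_def)
  qed (simp_all add: A_alpha_def outdegree_matrix_def adjacency_matrix_def)
  moreover have "distinct (map F vs)" "set (map F vs) = pverts H"
    using vs inj by (simp_all add: distinct_map pv)
  ultimately show ?thesis
    using A_alpha_spectral_radius_eq[OF vs] A_alpha_spectral_radius_eq[of "map F vs" H] by metis
qed

section \<open>Reduction of an infinity-digraph to its concrete copy\<close>

lemma cas_with_proj_map_snd:
  "pre_digraph.cas (with_proj G) u p v \<Longrightarrow> map fst p @ [v] = u # map snd p"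
proof (induction p arbitrary: u)
  case (Cons e p)
  thus ?case by (auto simp: pre_digraph.cas.simps with_proj_def)
qed (simp add: pre_digraph.cas.simps)

text \<open>A cycle may be listed from any of its vertices, whereas the concrete copy starts at the
  common one. Rotating the indices modulo the length makes \<open>w\<close> start at
  \<open>v\<close>; letting it also return to \<open>v\<close> at index \<open>length p\<close>
  spares a special case for the closing arc.\<close>

lemma cycle_param:
  assumes cyc: "pre_digraph.cycle (with_proj G) p" and v: "v \<in> fst ` set p"
  obtains w where "w 0 = v" "w (length p) = v" "inj_on w {..<length p}"
    "set p = (\<lambda>j. (w j, w (Suc j))) ` {..<length p}"
proof -
  define xs L where "xs = map fst p" and "L = length p"
  obtain u where u: "pre_digraph.awalk (with_proj G) u p u"
      "distinct (tl (pre_digraph.awalk_verts (with_proj G) u p))" "p \<noteq> []"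
    using cyc by (auto simp: pre_digraph.cycle_def)
  have cas: "pre_digraph.cas (with_proj G) u p u" using u(1) by (simp add: pre_digraph.awalk_def)
  \<comment> \<open>The walk is closed, so its heads are its tails shifted cyclically by one. This
    carries distinctness from the heads, where \<open>cycle\<close> provides it, to the
    tails.\<close>
  have snd_rot: "map snd p = rotate1 xs"
    using cas_with_proj_map_snd[OF cas] u(3) by (cases p) (auto simp: xs_def)
  have "tl (pre_digraph.awalk_verts (with_proj G) u p) = map snd p"
    using pre_digraph.awalk_verts_conv'[OF cas] u(3) by (simp add: with_proj_def)
  hence dist: "distinct xs" using u(2) snd_rot by simp
  have L: "L > 0" "length xs = L" using u(3) by (simp_all add: L_def xs_def)
  have nth: "p ! m = (xs ! m, xs ! (Suc m mod L))" if "m < L" for m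
  proof -
    have "snd (p ! m) = rotate1 xs ! m"
      using that by (simp add: L_def flip: snd_rot)
    thus ?thesis using that L by (simp add: nth_rotate1 prod_eq_iff xs_def L_def)
  qed
  obtain a where a: "a < L" "xs ! a = v"
    using v L by (metis in_set_conv_nth list.set_map xs_def)
  define w where "w j = xs ! ((a + j) mod L)" for j
  have step: "(w j, w (Suc j)) = p ! ((a + j) mod L)" for j
    using nth[of "(a + j) mod L"] L by (simp add: w_def mod_Suc_eq)
  have "(a + j) mod L = (if a + j < L then a + j else a + j - L)" if "j < L" for j
    using that a(1) by (simp add: mod_if)
  hence inj_mod: "inj_on (\<lambda>j. (a + j) mod L) {..<L}"
    by (intro inj_onI) (auto split: if_splits)
  have bij: "(\<lambda>j. (a + j) mod L) ` {..<L} = {..<L}"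
    using L by (intro endo_inj_surj inj_mod) auto
  have "inj_on w {..<L}"
  proof (rule inj_onI)
    fix j j' assume j: "j \<in> {..<L}" "j' \<in> {..<L}" "w j = w j'"
    hence "(a + j) mod L = (a + j') mod L"
      using L dist by (simp add: w_def nth_eq_iff_index_eq)
    thus "j = j'" using inj_onD[OF inj_mod, of j j'] j by simp
  qed
  moreover have "set p = (\<lambda>j. (w j, w (Suc j))) ` {..<L}"
  proof -
    have "set p = (!) p ` {..<L}" by (auto simp: L_def set_conv_nth)
    also have "\<dots> = (!) p ` (\<lambda>j. (a + j) mod L) ` {..<L}" unfolding bij ..
    finally show ?thesis unfolding step by (simp add: image_image)
  qed
  moreover have "w 0 = v" "w L = v" using a by (simp_all add: w_def)
  ultimately show ?thesis using that[of w] by (simp add: L_def)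
qed

text \<open>Each cycle is traversed from the common vertex \<open>v\<close>, and index
  \<open>j\<close> of cycle \<open>i\<close> is sent to \<open>w i j\<close>. Cycles meet in
  \<open>v\<close> only, which makes this map injective.\<close>

lemma pair_iso_infty_digraph:
  assumes "is_infty_digraph ks G"
  obtains F where "pair_iso F (infty_digraph ks) G"
proof -
  let ?s = "length ks"
  obtain v p where p: "2 \<le> ?s"
    "\<forall>i<?s. pre_digraph.cycle (with_proj G) (p i) \<and> length (p i) = ks ! i + 1"
    "\<forall>i<?s. \<forall>j<?s. i \<noteq> j \<longrightarrow> fst ` set (p i) \<inter> fst ` set (p j) = {v}"
    "pverts G = (\<Union>i<?s. fst ` set (p i))" "parcs G = (\<Union>i<?s. set (p i))"
    using assms unfolding is_infty_digraph_def by (elim conjE exE) (rule that; assumption)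
  have cyc: "pre_digraph.cycle (with_proj G) (p i)" "length (p i) = ks ! i + 1"
    if "i < ?s" for i using p(2) that by blast+
  have meet: "fst ` set (p i) \<inter> fst ` set (p j) = {v}" if "i < ?s" "j < ?s" "i \<noteq> j" for i j
    using p(3) that by blast
  have v: "v \<in> fst ` set (p i)" if "i < ?s" for i
  proof -
    \<comment> \<open>That \<open>v\<close> lies on cycle \<open>i\<close> comes from intersecting
      with another cycle, and one exists since there are at least two.\<close>
    have "\<exists>j<?s. i \<noteq> j" using p(1) by (intro exI[of _ "if i = 0 then 1 else 0"]) auto
    thus ?thesis using meet[OF that] by blast
  qed
  let ?P = "\<lambda>i w. w 0 = v \<and> w (ks ! i + 1) = v \<and> inj_on w {..<ks ! i + 1} \<and>
      set (p i) = (\<lambda>j. (w j, w (Suc j))) ` {..<ks ! i + 1}"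
  define w where "w i = (SOME w. ?P i w)" for i
  have "?P i (w i)" if "i < ?s" for i
  proof -
    have "\<exists>w. ?P i w" using cycle_param[OF cyc(1) v] cyc(2) that by metis
    thus ?thesis unfolding w_def by (rule someI_ex)
  qed
  hence w: "\<And>i. i < ?s \<Longrightarrow> w i 0 = v" "\<And>i. i < ?s \<Longrightarrow> w i (ks ! i + 1) = v"
    "\<And>i. i < ?s \<Longrightarrow> inj_on (w i) {..<ks ! i + 1}"
    "\<And>i. i < ?s \<Longrightarrow> set (p i) = (\<lambda>j. (w i j, w i (Suc j))) ` {..<ks ! i + 1}"
    by simp_all
  have tails: "fst ` set (p i) = w i ` {..<ks ! i + 1}" if "i < ?s" for i
    unfolding w(4)[OF that] by (simp add: image_image)
  define F where "F = (\<lambda>(i, j). w i j)"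
  \<comment> \<open>The range includes the closing index \<open>ks ! i + 1\<close>, where both sides
    return to the common vertex; this is what the last arc of each cycle requires.\<close>
  have F: "F (infty_vertex ks i j) = w i j" if "i < ?s" "j \<le> ks ! i + 1" for i j
  proof -
    have "w 0 0 = v" using w(1)[of 0] p(1) by (metis less_le_trans zero_less_numeral)
    thus ?thesis using that w(1,2)[of i] by (auto simp: F_def infty_vertex_def)
  qed
  have w_inj: "i = i' \<and> j = j' \<or> j = 0 \<and> j' = 0"
    if "i < ?s" "i' < ?s" "j \<le> ks ! i" "j' \<le> ks ! i'" "w i j = w i' j'" for i j i' j'
  proof (cases "i = i'")
    case True
    thus ?thesis using inj_onD[OF w(3)[of i], of j j'] that by auto
  next
    case False
    have "w i j \<in> fst ` set (p i)" using that(3) unfolding tails[OF that(1)] by (intro imageI) simp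
    moreover have "w i' j' \<in> fst ` set (p i')" using that(4) unfolding tails[OF that(2)] by (intro imageI) simp
    ultimately have "w i j = v" "w i' j' = v" using meet[OF that(1,2) False] that(5) by auto
    hence "w i j = w i 0" "w i' j' = w i' 0" using w(1) that by auto
    hence "j = 0" "j' = 0"
      using inj_onD[OF w(3)[of i], of j 0] inj_onD[OF w(3)[of i'], of j' 0] that by auto
    thus ?thesis by simp
  qed
  have "inj_on F (pverts (infty_digraph ks))"
  proof (rule inj_onI)
    fix x y assume xy: "x \<in> pverts (infty_digraph ks)" "y \<in> pverts (infty_digraph ks)" "F x = F y"
    obtain i j i' j' where ij: "x = infty_vertex ks i j" "y = infty_vertex ks i' j'"
        "i < ?s" "i' < ?s" "j \<le> ks ! i" "j' \<le> ks ! i'"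
      using xy(1,2) by (auto simp: infty_digraph_def)
    have "w i j = w i' j'" using xy(3) F ij by simp
    from w_inj[OF ij(3-6) this] show "x = y" by (auto simp: ij infty_vertex_def)
  qed
  moreover have "pverts G = F ` pverts (infty_digraph ks)"
  proof -
    have "pverts G = (\<Union>i<?s. w i ` {..<ks ! i + 1})"
      unfolding p(4) using tails by (intro SUP_cong) auto
    also have "\<dots> = (\<Union>i<?s. (\<lambda>j. F (infty_vertex ks i j)) ` {..<ks ! i + 1})"
      using F by (intro SUP_cong image_cong) auto
    also have "\<dots> = F ` (\<Union>i<?s. infty_vertex ks i ` {..<ks ! i + 1})"
      by (simp add: image_UN image_image)
    also have "(\<Union>i<?s. infty_vertex ks i ` {..<ks ! i + 1}) = pverts (infty_digraph ks)"
      by (fastforce simp: infty_digraph_def less_Suc_eq_le)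
    finally show ?thesis .
  qed
  moreover have "parcs G = map_prod F F ` parcs (infty_digraph ks)"
  proof -
    let ?e = "\<lambda>i j. (infty_vertex ks i j, infty_vertex ks i (Suc j))"
    have "parcs G = (\<Union>i<?s. (\<lambda>j. (w i j, w i (Suc j))) ` {..<ks ! i + 1})"
      unfolding p(5) using w(4) by (intro SUP_cong) auto
    also have "\<dots> = (\<Union>i<?s. (\<lambda>j. map_prod F F (?e i j)) ` {..<ks ! i + 1})"
      using F by (intro SUP_cong image_cong) auto
    also have "\<dots> = map_prod F F ` (\<Union>i<?s. ?e i ` {..<ks ! i + 1})"
      by (simp add: image_UN image_image)
    also have "(\<Union>i<?s. ?e i ` {..<ks ! i + 1}) = parcs (infty_digraph ks)"
      by (fastforce simp: infty_digraph_def less_Suc_eq_le)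
    finally show ?thesis .
  qed
  ultimately show ?thesis using that unfolding pair_iso_def by blast
qed

text \<open>Renumbering the cycles by a permutation that carries \<open>ks\<close> to
  \<open>ls\<close> suffices. The equality cases of the power sums determine the parameters only as
  a multiset.\<close>

lemma is_infty_digraph_mset_cong:
  assumes G: "is_infty_digraph ks G" and ms: "mset ks = mset ls"
  shows "is_infty_digraph ls G"
proof -
  let ?s = "length ks"
  obtain v p where p: "pair_digraph G" "2 \<le> ?s" "\<forall>k\<in>set ks. 1 \<le> k"
    "\<forall>i<?s. pre_digraph.cycle (with_proj G) (p i) \<and> length (p i) = ks ! i + 1"
    "\<forall>i<?s. \<forall>j<?s. i \<noteq> j \<longrightarrow> fst ` set (p i) \<inter> fst ` set (p j) = {v}"
    "pverts G = (\<Union>i<?s. fst ` set (p i))" "parcs G = (\<Union>i<?s. set (p i))"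
    using G unfolding is_infty_digraph_def by (elim conjE exE) (rule that; assumption)
  obtain \<pi> where \<pi>: "\<pi> permutes {..<?s}" "permute_list \<pi> ks = ls"
    using mset_eq_permutation[OF ms[symmetric]] by blast
  have len: "length ls = ?s" using ms by (rule mset_eq_length[symmetric])
  have img: "\<pi> ` {..<?s} = {..<?s}" using \<pi>(1) by (rule permutes_image)
  have lt: "\<pi> i < ?s" if "i < ?s" for i using that img by blast
  have nth: "ls ! i = ks ! \<pi> i" if "i < ?s" for i
    using permute_list_nth[OF \<pi>(1) that] \<pi>(2) by simp
  have inj: "\<pi> i \<noteq> \<pi> j" if "i \<noteq> j" for i j
    using that permutes_inj[OF \<pi>(1)] by (auto dest: injD)
  have "pverts G = (\<Union>i\<in>\<pi> ` {..<?s}. fst ` set (p i))" "parcs G = (\<Union>i\<in>\<pi> ` {..<?s}. set (p i))"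
    unfolding img using p(6,7) by simp_all
  hence "pverts G = (\<Union>i<?s. fst ` set (p (\<pi> i)))" "parcs G = (\<Union>i<?s. set (p (\<pi> i)))"
    by simp_all
  moreover have "\<forall>k\<in>set ls. 1 \<le> k" using p(3) mset_eq_setD[OF ms] by simp
  ultimately show ?thesis
    using p(1,2,4,5) lt nth inj unfolding is_infty_digraph_def len
    by (intro conjI exI[of _ v] exI[of _ "\<lambda>i. p (\<pi> i)"]) auto
qed

section \<open>Spectral radius of an \<open>\<infinity>\<close>-digraph\<close>

text \<open>Replacing indexed vectors by functions on vertices lets each row be read off from the
  successors of a vertex.\<close>

lemma eigenvalue_A_alpha_iff:
  fixes G :: "'a pair_pre_digraph" and k :: complex
  assumes G: "pair_digraph G" and vs: "distinct vs" "set vs = pverts G"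
  shows "eigenvalue (map_mat complex_of_real (A_alpha \<alpha> G vs)) k \<longleftrightarrow>
    (\<exists>f :: 'a \<Rightarrow> complex. (\<exists>x\<in>pverts G. f x \<noteq> 0) \<and>
      (\<forall>x\<in>pverts G. \<alpha> * real (card {y. (x, y) \<in> parcs G}) * f x +
        (1 - \<alpha>) * (\<Sum>y | (x, y) \<in> parcs G. f y) = k * f x))"
proof -
  interpret pair_digraph G by fact
  define m where "m x y = complex_of_real
    (\<alpha> * (if x = y then real (card {y. (x, y) \<in> parcs G}) else 0) +
     (1 - \<alpha>) * (if (x, y) \<in> parcs G then 1 else 0))" for x y
  have mat_eq: "map_mat complex_of_real (A_alpha \<alpha> G vs) =
      mat (length vs) (length vs) (\<lambda>(i, j). m (vs ! i) (vs ! j))"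
    using vs(1)
    by (intro eq_matI) (auto simp: A_alpha_def outdegree_matrix_def adjacency_matrix_def m_def
        nth_eq_iff_index_eq out_degree_with_proj)
  have "(\<Sum>y\<in>set vs. m x y * f y) = \<alpha> * real (card {y. (x, y) \<in> parcs G}) * f x +
        (1 - \<alpha>) * (\<Sum>y | (x, y) \<in> parcs G. f y)" if x: "x \<in> pverts G" for x and f :: "'a \<Rightarrow> complex"
  proof -
    have sub: "{y. (x, y) \<in> parcs G} \<subseteq> pverts G" by (auto dest: arc_snd_in_verts)
    have "m x y * f y = (if x = y then \<alpha> * real (card {y. (x, y) \<in> parcs G}) * f y else 0) +
        (1 - \<alpha>) * (if (x, y) \<in> parcs G then f y else 0)" for y
      by (simp add: m_def algebra_simps)
    hence "(\<Sum>y\<in>set vs. m x y * f y) = \<alpha> * real (card {y. (x, y) \<in> parcs G}) * f x +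
        (1 - \<alpha>) * (\<Sum>y\<in>pverts G. if (x, y) \<in> parcs G then f y else 0)"
      using x by (simp add: sum.distrib vs(2) flip: sum_distrib_left)
    also have "(\<Sum>y\<in>pverts G. if (x, y) \<in> parcs G then f y else 0) =
        (\<Sum>y | (x, y) \<in> parcs G. f y)"
      using sub by (intro sum.mono_neutral_cong_right) auto
    finally show ?thesis .
  qed
  thus ?thesis unfolding mat_eq eigenvalue_mat_enum[OF vs(1)] by (simp add: vs(2))
qed

section \<open>Eigenvalue equations of the concrete copy\<close>

lemma pverts_infty_digraph:
  assumes "ks \<noteq> []"
  shows "pverts (infty_digraph ks) = insert (0, 0) (Sigma {..<length ks} (\<lambda>i. {1..ks ! i}))"
    (is "_ = ?V")
proof (intro equalityI subsetI)
  fix x assume "x \<in> pverts (infty_digraph ks)"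
  then obtain i j where "x = infty_vertex ks i j" "i < length ks" "j \<le> ks ! i"
    by (auto simp: infty_digraph_def)
  thus "x \<in> ?V" by (simp add: infty_vertex_def)
next
  have mem: "infty_vertex ks i j \<in> pverts (infty_digraph ks)"
    if "i < length ks" "j \<le> ks ! i" for i j
    using that unfolding infty_digraph_def by auto
  fix x assume "x \<in> ?V"
  then consider "x = (0, 0)" | i j where "x = (i, j)" "i < length ks" "1 \<le> j" "j \<le> ks ! i"
    by auto
  thus "x \<in> pverts (infty_digraph ks)"
  proof cases
    case 1
    thus ?thesis using mem[of 0 0] assms by (simp add: infty_vertex_def)
  next
    case (2 i j)
    thus ?thesis using mem[of i j] by (simp add: infty_vertex_def)
  qed
qed

lemma card_pverts_infty_digraph:
  assumes "ks \<noteq> []"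
  shows "card (pverts (infty_digraph ks)) = sum_list ks + 1"
  by (simp add: pverts_infty_digraph[OF assms] sum_list_sum_nth atLeast0LessThan)

lemma successors_center:
  assumes "\<forall>k\<in>set ks. 1 \<le> k"
  shows "{y. ((0, 0), y) \<in> parcs (infty_digraph ks)} = (\<lambda>i. (i, 1)) ` {..<length ks}"
proof -
  have pos: "1 \<le> ks ! i" if "i < length ks" for i using assms that by simp
  have "(0, 0) = infty_vertex ks i j \<longleftrightarrow> j = 0" if "i < length ks" "j \<le> ks ! i" for i j
    using that by (auto simp: infty_vertex_def)
  hence "{y. ((0, 0), y) \<in> parcs (infty_digraph ks)} = (\<lambda>i. infty_vertex ks i 1) ` {..<length ks}"
    by (auto simp: infty_digraph_def)
  \<comment> \<open>As \<open>ks ! i\<close> is positive, index 1 differs from the closing index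
    \<open>ks ! i + 1\<close> and names a proper path vertex.\<close>
  also have "\<dots> = (\<lambda>i. (i, 1)) ` {..<length ks}"
    using pos by (intro image_cong) (fastforce simp: infty_vertex_def)+
  finally show ?thesis .
qed

lemma successors_path:
  assumes "i < length ks" "1 \<le> j" "j \<le> ks ! i"
  shows "{y. ((i, j), y) \<in> parcs (infty_digraph ks)} = {infty_vertex ks i (j + 1)}"
proof -
  have "(i, j) = infty_vertex ks i' j' \<longleftrightarrow> i' = i \<and> j' = j" if "j' \<le> ks ! i'" for i' j'
    using that assms by (auto simp: infty_vertex_def)
  thus ?thesis using assms by (auto simp: infty_digraph_def)
qed

lemma eigenvalue_infty_digraph_iff:
  fixes k :: complex
  assumes ks: "2 \<le> length ks" "\<forall>k\<in>set ks. 1 \<le> k"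
    and vs: "distinct vs" "set vs = pverts (infty_digraph ks)"
  shows "eigenvalue (map_mat complex_of_real (A_alpha \<alpha> (infty_digraph ks) vs)) k \<longleftrightarrow>
    (\<exists>f :: nat \<times> nat \<Rightarrow> complex. (\<exists>x\<in>pverts (infty_digraph ks). f x \<noteq> 0) \<and>
      complex_of_real \<alpha> * of_nat (length ks) * f (0, 0) +
        (1 - complex_of_real \<alpha>) * (\<Sum>i<length ks. f (i, 1)) = k * f (0, 0) \<and>
      (\<forall>i<length ks. \<forall>j\<in>{1..ks ! i}.
        complex_of_real \<alpha> * f (i, j) +
          (1 - complex_of_real \<alpha>) * f (infty_vertex ks i (j + 1)) = k * f (i, j)))"
proof -
  have ne: "ks \<noteq> []" using ks(1) by auto
  have "pair_digraph (infty_digraph ks)"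
    using is_infty_digraph_infty_digraph[OF ks] by (simp add: is_infty_digraph_def)
  note ev = eigenvalue_A_alpha_iff[OF this vs, of \<alpha> k]
  have split: "(\<forall>x\<in>pverts (infty_digraph ks). P x) \<longleftrightarrow>
      P (0, 0) \<and> (\<forall>i<length ks. \<forall>j\<in>{1..ks ! i}. P (i, j))" for P
    unfolding pverts_infty_digraph[OF ne] by auto
  show ?thesis
    unfolding ev split successors_center[OF ks(2)]
    by (simp add: successors_path card_image inj_on_def sum.reindex)
qed

lemma sum_list_map_conv_nth: "(\<Sum>x\<leftarrow>xs. g x) = (\<Sum>i<length xs. g (xs ! i))"
  by (simp add: sum_list_sum_nth atLeast0LessThan)

text \<open>Two halves: \<open>upper\<close> bounds the modulus of every complex eigenvalue, and
  \<open>attained\<close> exhibits a positive eigenvector for the bound itself.\<close>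

lemma spectral_radius_infty_digraph:
  fixes \<alpha> \<mu> :: real
  assumes \<alpha>: "0 \<le> \<alpha>" "\<alpha> < 1" and ks: "2 \<le> length ks" "\<forall>k\<in>set ks. 1 \<le> k"
    and \<mu>: "1 < \<mu>"
    and root: "\<mu> = \<alpha> * (real (length ks) - 1) / (1 - \<alpha>) + (\<Sum>k\<leftarrow>ks. (1 / \<mu>) ^ k)"
  shows "A_alpha_spectral_radius \<alpha> (infty_digraph ks) = \<alpha> + (1 - \<alpha>) * \<mu>"
proof -
  let ?G = "infty_digraph ks" and ?s = "length ks"
  define c where "c = \<alpha> * (real ?s - 1) / (1 - \<alpha>)"
  have c: "(1 - \<alpha>) * c = \<alpha> * (real ?s - 1)" using \<alpha> by (simp add: c_def)
  have ne: "ks \<noteq> []" using ks(1) by auto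
  have "finite (pverts ?G)" unfolding pverts_infty_digraph[OF ne] by auto
  then obtain vs where vs: "distinct vs" "set vs = pverts ?G"
    using finite_distinct_list by blast
  define M where "M = map_mat complex_of_real (A_alpha \<alpha> ?G vs)"
  have carr: "M \<in> carrier_mat (length vs) (length vs)"
    by (simp add: M_def A_alpha_def outdegree_matrix_def adjacency_matrix_def)
  note ev = eigenvalue_infty_digraph_iff[OF ks vs, of \<alpha>, folded M_def]
  let ?a = "complex_of_real \<alpha>"
  have upper: "norm k \<le> \<alpha> + (1 - \<alpha>) * \<mu>" if ek: "eigenvalue M k" for k
  proof (cases "k = ?a")
    \<comment> \<open>The recursion along the paths divides by \<open>k - \<alpha>\<close>, so this
      value is treated apart.\<close>
    case True
    thus ?thesis using \<alpha> \<mu> by simp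
  next
    case False
    obtain f :: "nat \<times> nat \<Rightarrow> complex" where f: "\<exists>x\<in>pverts ?G. f x \<noteq> 0"
      "?a * of_nat ?s * f (0, 0) + (1 - ?a) * (\<Sum>i<?s. f (i, 1)) = k * f (0, 0)"
      "\<forall>i<?s. \<forall>j\<in>{1..ks ! i}.
         ?a * f (i, j) + (1 - ?a) * f (infty_vertex ks i (j + 1)) = k * f (i, j)"
      using ek[unfolded ev] by (elim exE conjE) (rule that; assumption)
    \<comment> \<open>\<open>t\<close> is the reciprocal of the complex \<mu> belonging to
      \<open>k\<close>: the ratio of an entry to its successor along a path.\<close>
    define t where "t = (1 - ?a) / (k - ?a)"
    \<comment> \<open>The exponent is the number of arcs from \<open>(i, j)\<close> to the common
      vertex, so the induction runs backwards from the last path vertex.\<close>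
    have path: "f (i, j) = t ^ (ks ! i + 1 - j) * f (0, 0)"
      if i: "i < ?s" and j: "1 \<le> j" "j \<le> ks ! i" for i j
      using j(2,1)
    proof (induction rule: inc_induct)
      case base
      have "(k - ?a) * f (i, ks ! i) = (1 - ?a) * f (0, 0)"
        using f(3)[rule_format, OF i, of "ks ! i"] base by (simp add: infty_vertex_def algebra_simps)
      thus ?case using False by (simp add: t_def field_simps)
    next
      case (step j)
      have "(k - ?a) * f (i, j) = (1 - ?a) * f (i, Suc j)"
        using f(3)[rule_format, OF i, of j] step by (simp add: infty_vertex_def algebra_simps)
      hence "f (i, j) = t * f (i, Suc j)" using False by (simp add: t_def field_simps)
      thus ?case using step by (simp add: Suc_diff_le)
    qed
    \<comment> \<open>All entries are multiples of the central one, so it cannot vanish and may be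
      cancelled.\<close>
    have f0: "f (0, 0) \<noteq> 0"
      using f(1) path unfolding pverts_infty_digraph[OF ne] by auto
    have "(\<Sum>i<?s. f (i, 1)) = (\<Sum>k\<leftarrow>ks. t ^ k) * f (0, 0)"
      unfolding sum_list_map_conv_nth sum_distrib_right using path ks(2) by (intro sum.cong) auto
    hence "(?a * of_nat ?s + (1 - ?a) * (\<Sum>k\<leftarrow>ks. t ^ k)) * f (0, 0) = k * f (0, 0)"
      using f(2) by (simp add: algebra_simps)
    hence "?a * of_nat ?s + (1 - ?a) * (\<Sum>k\<leftarrow>ks. t ^ k) = k"
      using f0 by (metis mult_right_cancel)
    hence k: "k - ?a = of_real (\<alpha> * (real ?s - 1)) + of_real (1 - \<alpha>) * (\<Sum>k\<leftarrow>ks. t ^ k)"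
      by (simp add: algebra_simps)
    \<comment> \<open>\<open>m\<close> is the modulus of the complex \<mu>, so
      \<open>norm t = 1 / m\<close>. The triangle inequality turns the equation for \<open>k\<close>
      into the real inequality \<open>le\<close>.\<close>
    define m where "m = norm (k - ?a) / (1 - \<alpha>)"
    have m: "m > 0" "norm (k - ?a) = (1 - \<alpha>) * m" using False \<alpha> by (simp_all add: m_def)
    have "norm (1 - ?a) = 1 - \<alpha>"
      using norm_of_real[of "1 - \<alpha>", where 'a = complex] \<alpha> by simp
    hence "norm t = 1 / m" by (simp add: t_def m_def norm_divide)
    hence "norm (\<Sum>k\<leftarrow>ks. t ^ k) \<le> (\<Sum>k\<leftarrow>ks. (1 / m) ^ k)"
      unfolding sum_list_map_conv_nth
      using norm_sum[of "\<lambda>i. t ^ (ks ! i)" "{..<?s}"] by (simp add: norm_power)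
    hence "norm (of_real (1 - \<alpha>) * (\<Sum>k\<leftarrow>ks. t ^ k)) \<le> (1 - \<alpha>) * (\<Sum>k\<leftarrow>ks. (1 / m) ^ k)"
      using \<alpha> unfolding norm_mult norm_of_real by (intro mult_mono) auto
    moreover have "norm (complex_of_real (\<alpha> * (real ?s - 1))) = \<alpha> * (real ?s - 1)"
      using \<alpha> ks(1) unfolding norm_of_real by simp
    ultimately have "(1 - \<alpha>) * m \<le> \<alpha> * (real ?s - 1) + (1 - \<alpha>) * (\<Sum>k\<leftarrow>ks. (1 / m) ^ k)"
      unfolding m(2)[symmetric]
      by (subst k) (smt (verit) norm_triangle_ineq)
    hence "(1 - \<alpha>) * m \<le> (1 - \<alpha>) * (c + (\<Sum>k\<leftarrow>ks. (1 / m) ^ k))"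
      using c by (simp add: distrib_left)
    hence le: "m \<le> c + (\<Sum>k\<leftarrow>ks. (1 / m) ^ k)" using \<alpha> by simp
    \<comment> \<open>If \<open>m\<close> exceeded \<mu>, the decreasing right-hand side would be at
      most its value at \<mu>, which is \<mu>, contradicting \<open>le\<close>.\<close>
    have "m \<le> \<mu>"
    proof (rule ccontr)
      assume "\<not> m \<le> \<mu>"
      hence "(\<Sum>k\<leftarrow>ks. (1 / m) ^ k) \<le> (\<Sum>k\<leftarrow>ks. (1 / \<mu>) ^ k)"
        using \<mu> by (intro sum_powers_inverse_antimono) auto
      thus False using le root \<open>\<not> m \<le> \<mu>\<close> by (simp add: c_def)
    qed
    have "norm k \<le> norm (complex_of_real \<alpha>) + norm (k - ?a)"
      by (metis add.commute diff_add_cancel norm_triangle_ineq)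
    also have "\<dots> = \<alpha> + (1 - \<alpha>) * m" using \<alpha> m(2) by simp
    also have "\<dots> \<le> \<alpha> + (1 - \<alpha>) * \<mu>" using \<alpha> \<open>m \<le> \<mu>\<close> by simp
    finally show ?thesis .
  qed
  have attained: "eigenvalue M (complex_of_real (\<alpha> + (1 - \<alpha>) * \<mu>))"
    unfolding ev
  proof (intro exI conjI)
    \<comment> \<open>This is the path formula from the upper bound with ratio
      \<open>1 / \<mu>\<close>, normalised to 1 at the common vertex.\<close>
    let ?g = "\<lambda>(i, j). if j = 0 then 1 else (1 / \<mu>) ^ (ks ! i + 1 - j)"
    let ?f = "\<lambda>x. complex_of_real (?g x)"
    show "\<exists>x\<in>pverts ?G. ?f x \<noteq> 0"
      by (intro bexI[of _ "(0, 0)"]) (simp_all add: pverts_infty_digraph[OF ne])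
    have "(1 - \<alpha>) * \<mu> = (1 - \<alpha>) * (c + (\<Sum>k\<leftarrow>ks. (1 / \<mu>) ^ k))"
      using root by (simp add: c_def)
    hence "\<alpha> * real ?s + (1 - \<alpha>) * (\<Sum>i<?s. ?g (i, 1)) = \<alpha> + (1 - \<alpha>) * \<mu>"
      using c by (simp add: distrib_left right_diff_distrib sum_list_map_conv_nth)
    hence "complex_of_real (\<alpha> * real ?s + (1 - \<alpha>) * (\<Sum>i<?s. ?g (i, 1))) =
        complex_of_real (\<alpha> + (1 - \<alpha>) * \<mu>)" by simp
    thus "?a * of_nat ?s * ?f (0, 0) + (1 - ?a) * (\<Sum>i<?s. ?f (i, 1)) =
        complex_of_real (\<alpha> + (1 - \<alpha>) * \<mu>) * ?f (0, 0)"
      by simp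
    show "\<forall>i<?s. \<forall>j\<in>{1..ks ! i}. ?a * ?f (i, j) + (1 - ?a) * ?f (infty_vertex ks i (j + 1)) =
        complex_of_real (\<alpha> + (1 - \<alpha>) * \<mu>) * ?f (i, j)"
    proof (intro allI impI ballI)
      fix i j assume i: "i < ?s" and j: "j \<in> {1..ks ! i}"
      \<comment> \<open>For \<open>j = ks ! i\<close> the successor is the common vertex, whose
        value 1 is the power with exponent 0.\<close>
      have "?g (infty_vertex ks i (j + 1)) = (1 / \<mu>) ^ (ks ! i - j)"
        using j by (auto simp: infty_vertex_def)
      moreover have "?g (i, j) = (1 / \<mu>) * (1 / \<mu>) ^ (ks ! i - j)"
        using j by (auto simp: Suc_diff_le)
      ultimately have g: "\<alpha> * ?g (i, j) + (1 - \<alpha>) * ?g (infty_vertex ks i (j + 1)) =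
          (\<alpha> + (1 - \<alpha>) * \<mu>) * ?g (i, j)"
        using \<mu> by (simp add: distrib_right add_divide_distrib)
      show "?a * ?f (i, j) + (1 - ?a) * ?f (infty_vertex ks i (j + 1)) =
        complex_of_real (\<alpha> + (1 - \<alpha>) * \<mu>) * ?f (i, j)"
        using arg_cong[OF g, of complex_of_real]
        by (simp only: of_real_add of_real_mult of_real_diff of_real_1)
    qed
  qed
  have "Max (norm ` spectrum M) = \<alpha> + (1 - \<alpha>) * \<mu>"
  proof (rule Max_eqI)
    show "finite (norm ` spectrum M)" using card_finite_spectrum(1)[OF carr] by simp
    show "y \<le> \<alpha> + (1 - \<alpha>) * \<mu>" if "y \<in> norm ` spectrum M" for y
      using that upper by (auto simp: spectrum_def)
    have "norm (complex_of_real (\<alpha> + (1 - \<alpha>) * \<mu>)) = \<alpha> + (1 - \<alpha>) * \<mu>"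
      unfolding norm_of_real using \<alpha> \<mu> by simp
    thus "\<alpha> + (1 - \<alpha>) * \<mu> \<in> norm ` spectrum M"
      using attained by (metis imageI mem_Collect_eq spectrum_def)
  qed
  thus ?thesis
    unfolding A_alpha_spectral_radius_eq[OF vs] spectral_radius_def M_def .
qed

text \<open>Lists of equal length share the constant \<open>c\<close>, so their equations differ
  only in the power sums, and larger sums move the root to the right. If the roots coincide, so do
  the power sums at the single point \<open>1 / \<mu>\<close>.\<close>

lemma spectral_radius_infty_digraph_mono:
  fixes \<alpha> :: real
  assumes \<alpha>: "0 \<le> \<alpha>" "\<alpha> < 1"
    and ks: "2 \<le> length ks" "\<forall>k\<in>set ks. 1 \<le> k"
    and ls: "length ls = length ks" "\<forall>l\<in>set ls. 1 \<le> l"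
    and le: "\<And>x :: real. \<lbrakk>0 < x; x < 1\<rbrakk> \<Longrightarrow> (\<Sum>k\<leftarrow>ks. x ^ k) \<le> (\<Sum>l\<leftarrow>ls. x ^ l)"
    and eq: "\<And>x :: real. \<lbrakk>0 < x; x < 1; (\<Sum>k\<leftarrow>ks. x ^ k) = (\<Sum>l\<leftarrow>ls. x ^ l)\<rbrakk>
      \<Longrightarrow> mset ks = mset ls"
  shows "A_alpha_spectral_radius \<alpha> (infty_digraph ks)
      \<le> A_alpha_spectral_radius \<alpha> (infty_digraph ls)"
    and "A_alpha_spectral_radius \<alpha> (infty_digraph ks)
      = A_alpha_spectral_radius \<alpha> (infty_digraph ls) \<Longrightarrow> mset ks = mset ls"
proof -
  define c where "c = \<alpha> * (real (length ks) - 1) / (1 - \<alpha>)"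
  have c: "0 \<le> c" using \<alpha> ks(1) by (simp add: c_def)
  obtain \<mu> where \<mu>: "1 < \<mu>" "\<mu> = c + (\<Sum>k\<leftarrow>ks. (1 / \<mu>) ^ k)"
    using exists_root_gt_one[OF c ks(1)] by blast
  obtain \<nu> where \<nu>: "1 < \<nu>" "\<nu> = c + (\<Sum>l\<leftarrow>ls. (1 / \<nu>) ^ l)"
    using exists_root_gt_one[OF c, of ls] ks(1) ls(1) by auto
  have \<rho>\<mu>: "A_alpha_spectral_radius \<alpha> (infty_digraph ks) = \<alpha> + (1 - \<alpha>) * \<mu>"
    using \<mu> by (intro spectral_radius_infty_digraph \<alpha> ks) (simp_all add: c_def)
  have \<rho>\<nu>: "A_alpha_spectral_radius \<alpha> (infty_digraph ls) = \<alpha> + (1 - \<alpha>) * \<nu>"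
    using \<nu> ks ls by (intro spectral_radius_infty_digraph \<alpha>) (simp_all add: c_def)
  have x: "0 < 1 / \<mu>" "1 / \<mu> < 1" using \<mu>(1) by simp_all
  \<comment> \<open>If \<nu> < \<mu>, then passing from \<open>ks\<close> to \<open>ls\<close> at
    \<open>1 / \<mu>\<close> and from there to \<open>1 / \<nu>\<close> only enlarges the sum,
    whence \<mu> \<le> \<nu>.\<close>
  have "\<mu> \<le> \<nu>"
  proof (rule ccontr)
    assume "\<not> \<mu> \<le> \<nu>"
    hence "(\<Sum>l\<leftarrow>ls. (1 / \<mu>) ^ l) \<le> (\<Sum>l\<leftarrow>ls. (1 / \<nu>) ^ l)"
      using \<nu>(1) by (intro sum_powers_inverse_antimono) auto
    thus False using le[OF x] \<mu>(2) \<nu>(2) \<open>\<not> \<mu> \<le> \<nu>\<close> by linarith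
  qed
  thus "A_alpha_spectral_radius \<alpha> (infty_digraph ks)
      \<le> A_alpha_spectral_radius \<alpha> (infty_digraph ls)"
    using \<alpha> unfolding \<rho>\<mu> \<rho>\<nu> by simp
  assume "A_alpha_spectral_radius \<alpha> (infty_digraph ks)
      = A_alpha_spectral_radius \<alpha> (infty_digraph ls)"
  hence "\<mu> = \<nu>" using \<alpha> unfolding \<rho>\<mu> \<rho>\<nu> by simp
  thus "mset ks = mset ls" using eq[OF x] \<mu>(2) \<nu>(2) by simp
qed

section \<open>From concrete copies to the whole class\<close>

lemma infty_digraph_in_infty_digraphs:
  assumes "2 \<le> length ks" "\<forall>k\<in>set ks. 1 \<le> k"
  shows "infty_digraph ks \<in> infty_digraphs (sum_list ks + 1) (length ks)"
proof -
  have "card (pverts (infty_digraph ks)) = sum_list ks + 1"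
    using assms by (intro card_pverts_infty_digraph) auto
  thus ?thesis
    using is_infty_digraph_infty_digraph[OF assms] unfolding infty_digraphs_def by blast
qed

text \<open>Membership fixes the number of vertices, not the parameters. Counting the vertices of
  the concrete copy turns that number into the sum constraint on the exponents.\<close>

lemma infty_digraphs_cases:
  assumes "G \<in> infty_digraphs n s"
  obtains ks where "is_infty_digraph ks G" "length ks = s" "2 \<le> length ks" "\<forall>k\<in>set ks. 1 \<le> k"
    "sum_list ks + 1 = n"
    "\<And>\<alpha>. A_alpha_spectral_radius \<alpha> G = A_alpha_spectral_radius \<alpha> (infty_digraph ks)"
proof -
  obtain ks where ks: "is_infty_digraph ks G" "length ks = s" "card (pverts G) = n"
    using assms by (auto simp: infty_digraphs_def)
  have ks': "2 \<le> length ks" "\<forall>k\<in>set ks. 1 \<le> k" using ks(1) by (auto simp: is_infty_digraph_def)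
  obtain F where F: "pair_iso F (infty_digraph ks) G" using pair_iso_infty_digraph[OF ks(1)] .
  have "card (pverts G) = card (pverts (infty_digraph ks))"
    using F by (auto simp: pair_iso_def card_image)
  also have "\<dots> = sum_list ks + 1" using ks'(1) by (intro card_pverts_infty_digraph) auto
  finally have sum: "sum_list ks + 1 = n" using ks(3) by simp
  have pd: "pair_digraph (infty_digraph ks)"
    using is_infty_digraph_infty_digraph[OF ks'] by (simp add: is_infty_digraph_def)
  show ?thesis
    using that[OF ks(1,2) ks' sum] A_alpha_spectral_radius_pair_iso[OF pd F] by blast
qed

lemma digraph_iso_infty_digraph:
  assumes "is_infty_digraph ks G" "mset ks = mset ls"
  shows "digraph_iso (with_proj G) (with_proj (infty_digraph ls))"
proof -
  have ls: "is_infty_digraph ls G" by (rule is_infty_digraph_mset_cong[OF assms])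
  then obtain F where F: "pair_iso F (infty_digraph ls) G" by (rule pair_iso_infty_digraph)
  have "2 \<le> length ls" "\<forall>k\<in>set ls. 1 \<le> k" using ls by (auto simp: is_infty_digraph_def)
  hence "pair_digraph (infty_digraph ls)"
    using is_infty_digraph_infty_digraph by (auto simp: is_infty_digraph_def)
  thus ?thesis using digraph_iso_if_pair_iso[OF _ F] digraph_iso_pair_sym by blast
qed

lemma spectral_radius_digraph_iso:
  assumes "pair_digraph G" "digraph_iso (with_proj G) (with_proj H)"
  shows "A_alpha_spectral_radius \<alpha> G = A_alpha_spectral_radius \<alpha> H"
proof -
  obtain F where "pair_iso F G H" using assms(2) by (rule pair_iso_if_digraph_iso)
  from A_alpha_spectral_radius_pair_iso[OF assms(1) this] show ?thesis ..
qed

lemma balanced_params_eq: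
  assumes "2 \<le> s" "s + 1 \<le> n"
  shows "balanced_params n s =
    replicate (s - (n - 1) mod s) ((n - 1) div s) @ replicate ((n - 1) mod s) ((n - 1) div s + 1)"
proof -
  define N q r where "N = n - 1" and "q = N div s" and "r = N mod s"
  have N: "real n - 1 = real N" using assms by (simp add: N_def)
  have fl: "nat \<lfloor>real N / real s\<rfloor> = q"
    by (simp add: q_def floor_divide_of_nat_eq)
  have Nq: "N = s * q + r" by (simp add: q_def r_def)
  have r: "r < s" using assms by (simp add: r_def)
  \<comment> \<open>For \<open>r = 0\<close> the ceiling is \<open>q\<close>, but then no entry of
    the list takes the ceiling value.\<close>
  have ce: "nat \<lceil>real N / real s\<rceil> = q + 1" if "r > 0"
  proof -
    have "\<lceil>real N / real s\<rceil> = int q + 1"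
      using that r assms by (intro ceiling_unique) (simp_all add: Nq field_simps)
    thus ?thesis by simp
  qed
  have "balanced_params n s =
      map (\<lambda>i. if i \<le> s - r then q else nat \<lceil>real N / real s\<rceil>) [1..<s + 1]"
    unfolding balanced_params_def Let_def N fl N_def[symmetric] using Nq by simp
  also have "\<dots> = replicate (s - r) q @ replicate r (q + 1)"
    using r ce by (intro nth_equalityI) (auto simp: nth_append simp del: upt_Suc)
  finally show ?thesis unfolding q_def r_def N_def .
qed

theorem theorem2p3:
  fixes \<alpha> :: real and s n :: nat
  assumes "0 \<le> \<alpha>" and "\<alpha> < 1" and "2 \<le> s" and "s + 1 \<le> n"
  shows
    "infty_digraph (replicate (s - 1) 1 @ [n - s]) \<in> infty_digraphs n s \<and>
     (\<forall>G \<in> (infty_digraphs n s :: 'a pair_pre_digraph set).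
        A_alpha_spectral_radius \<alpha> G
          \<le> A_alpha_spectral_radius \<alpha> (infty_digraph (replicate (s - 1) 1 @ [n - s])) \<and>
        (A_alpha_spectral_radius \<alpha> G
           = A_alpha_spectral_radius \<alpha> (infty_digraph (replicate (s - 1) 1 @ [n - s]))
         \<longleftrightarrow> digraph_iso (with_proj G)
               (with_proj (infty_digraph (replicate (s - 1) 1 @ [n - s]))))) \<and>
     infty_digraph (balanced_params n s) \<in> infty_digraphs n s \<and>
     (\<forall>G \<in> (infty_digraphs n s :: 'a pair_pre_digraph set).
        A_alpha_spectral_radius \<alpha> (infty_digraph (balanced_params n s))
          \<le> A_alpha_spectral_radius \<alpha> G \<and>
        (A_alpha_spectral_radius \<alpha> G
           = A_alpha_spectral_radius \<alpha> (infty_digraph (balanced_params n s))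
         \<longleftrightarrow> digraph_iso (with_proj G) (with_proj (infty_digraph (balanced_params n s)))))"
proof (intro conjI ballI)
  let ?E = "replicate (s - 1) 1 @ [n - s]" and ?B = "balanced_params n s"
  define q r where "q = (n - 1) div s" and "r = (n - 1) mod s"
  have r: "r < s" using assms(3) by (simp add: r_def)
  have nqr: "n = s * q + r + 1"
    using assms(3,4) mult_div_mod_eq[of s "n - 1"] unfolding q_def r_def by linarith
  have B: "?B = replicate (s - r) q @ replicate r (q + 1)"
    using balanced_params_eq[OF assms(3,4)] by (simp add: q_def r_def)
  \<comment> \<open>The bound on \<open>n\<close> makes the quotient positive, so the balanced
    parameters are admissible.\<close>
  have "s * 1 \<le> n - 1" using assms(4) by simp
  hence q: "1 \<le> q" using assms(3) by (simp add: q_def Suc_le_eq div_greater_zero_iff)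
  have E_params: "length ?E = s" "\<forall>k\<in>set ?E. 1 \<le> k" "sum_list ?E + 1 = n"
    using assms(3,4) by (auto simp: sum_list_replicate)
  have B_params: "length ?B = s" "\<forall>k\<in>set ?B. 1 \<le> k"
    using q r by (auto simp: B)
  have "sum_list ?B = (s - r) * q + r * (q + 1)" by (simp add: B sum_list_replicate)
  also have "\<dots> = ((s - r) + r) * q + r"
    by (simp only: distrib_right distrib_left mult_1_right add.assoc)
  finally have B_sum: "sum_list ?B + 1 = n" using r nqr by simp
  show "infty_digraph ?E \<in> infty_digraphs n s"
    using infty_digraph_in_infty_digraphs[of ?E] E_params assms(3) by simp
  show "infty_digraph ?B \<in> infty_digraphs n s"
    using infty_digraph_in_infty_digraphs[of ?B] B_params B_sum assms(3) by simp
  fix G :: "'a pair_pre_digraph"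
  assume "G \<in> infty_digraphs n s"
  then obtain ks where G: "is_infty_digraph ks G"
    and ks: "length ks = s" "2 \<le> length ks" "\<forall>k\<in>set ks. 1 \<le> k" "sum_list ks + 1 = n"
    and \<rho>: "\<And>\<alpha>. A_alpha_spectral_radius \<alpha> G = A_alpha_spectral_radius \<alpha> (infty_digraph ks)"
    by (rule infty_digraphs_cases) blast
  have pd: "pair_digraph G" using G by (simp add: is_infty_digraph_def)
  have ks_ne: "ks \<noteq> []" using ks(2) by auto
  have E_eq: "?E = replicate (length ks - 1) 1 @ [sum_list ks + 1 - length ks]"
    using ks(1,4) by simp
  have le_E: "(\<Sum>k\<leftarrow>ks. x ^ k) \<le> (\<Sum>k\<leftarrow>?E. x ^ k)"
    and eq_E: "(\<Sum>k\<leftarrow>ks. x ^ k) = (\<Sum>k\<leftarrow>?E. x ^ k) \<Longrightarrow> mset ks = mset ?E"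
    if "0 < x" "x < 1" for x :: real
    using sum_powers_le_extreme[OF that ks_ne ks(3)] unfolding E_eq by blast+
  have E_len: "length ?E = length ks" using E_params(1) ks(1) by simp
  \<comment> \<open>Here \<open>ks\<close> has the smaller power sums; in the minimum part below it
    takes the place of the larger list, with the balanced one as the smaller.\<close>
  note max = spectral_radius_infty_digraph_mono
    [OF assms(1,2) ks(2,3) E_len E_params(2) le_E eq_E]
  show "A_alpha_spectral_radius \<alpha> G \<le> A_alpha_spectral_radius \<alpha> (infty_digraph ?E)"
    unfolding \<rho> by (rule max(1))
  show "A_alpha_spectral_radius \<alpha> G = A_alpha_spectral_radius \<alpha> (infty_digraph ?E)
      \<longleftrightarrow> digraph_iso (with_proj G) (with_proj (infty_digraph ?E))"
  proof
    assume "A_alpha_spectral_radius \<alpha> G = A_alpha_spectral_radius \<alpha> (infty_digraph ?E)"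
    hence "mset ks = mset ?E" unfolding \<rho> by (intro max(2))
    thus "digraph_iso (with_proj G) (with_proj (infty_digraph ?E))"
      by (rule digraph_iso_infty_digraph[OF G])
  qed (rule spectral_radius_digraph_iso[OF pd])
  have sum: "sum_list ks = length ks * q + r" and r': "r \<le> length ks"
    using ks(1,4) nqr r by simp_all
  have B_eq: "?B = replicate (length ks - r) q @ replicate r (q + 1)" using B ks(1) by simp
  have le_B: "(\<Sum>k\<leftarrow>?B. x ^ k) \<le> (\<Sum>k\<leftarrow>ks. x ^ k)"
    and eq_B: "(\<Sum>k\<leftarrow>?B. x ^ k) = (\<Sum>k\<leftarrow>ks. x ^ k) \<Longrightarrow> mset ?B = mset ks"
    if "0 < x" "x < 1" for x :: real
    using sum_powers_ge_balanced[OF that sum r'] unfolding B_eq by simp_all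
  have B_len: "2 \<le> length ?B" "length ks = length ?B" using B_params(1) ks(1) assms(3) by simp_all
  note min = spectral_radius_infty_digraph_mono
    [OF assms(1,2) B_len(1) B_params(2) B_len(2) ks(3) le_B eq_B]
  show "A_alpha_spectral_radius \<alpha> (infty_digraph ?B) \<le> A_alpha_spectral_radius \<alpha> G"
    unfolding \<rho> by (rule min(1))
  show "A_alpha_spectral_radius \<alpha> G = A_alpha_spectral_radius \<alpha> (infty_digraph ?B)
      \<longleftrightarrow> digraph_iso (with_proj G) (with_proj (infty_digraph ?B))"
  proof
    assume "A_alpha_spectral_radius \<alpha> G = A_alpha_spectral_radius \<alpha> (infty_digraph ?B)"
    hence "A_alpha_spectral_radius \<alpha> (infty_digraph ?B) = A_alpha_spectral_radius \<alpha> (infty_digraph ks)"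
      unfolding \<rho> ..
    hence "mset ?B = mset ks" by (intro min(2))
    from digraph_iso_infty_digraph[OF G this[symmetric]]
    show "digraph_iso (with_proj G) (with_proj (infty_digraph ?B))" .
  qed (rule spectral_radius_digraph_iso[OF pd])
qed

end
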